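(* Let $(W,\omega)$ be a real symplectic vector space of dimension $2n$, let $I\subset\mathbb{R}$ be an open interval and let $\Gamma\colon I\to\mathscr{L}(W)$ be a regular Jacobi curve. For every $\tau\in I$ there exists a unique $\Delta_\tau\in\Gamma(\tau)^{\pitchfork}$ such that $\Gamma''_{\Delta_\tau}(\tau)=0$.
   Context: $(u|v):=\omega(u,v)$. $\mathscr{L}(W)$ is the Lagrangian Grassmannian of $(W,\omega)$ with its usual smooth manifold structure. For $\Lambda\in\mathscr{L}(W)$, $\Lambda^{\pitchfork}=\{\Gamma\in\mathscr{L}(W):\Gamma\cap\Lambda=\{0\}\}$, an open subset. Affine structure on $\Delta^{\pitchfork}$: fix $\Gamma_0\in\Delta^{\pitchfork}$. Each $\Gamma\in\Delta^{\pitchfork}$ is the graph of a unique linear map $\langle\Gamma_0,\Gamma,\Delta\rangle\colon\Gamma_0\to\Delta$ (i.e. $\langle\Gamma_0,\Gamma,\Delta\rangle(v)=\bar v$ iff $v+\bar v\in\Gamma$, for $v\in\Gamma_0$, $\bar v\in\Delta$), and $\Gamma\mapsto\langle\Gamma_0,\Gamma,\Delta\rangle$ is a bijection of $\Delta^{\pitchfork}$ onto the vector space $\mathcal{S}(\Gamma_0,\Delta)=\{A\colon\Gamma_0\to\Delta\ \text{linear}: (Au|v)+(u|Av)=0\ \forall u,v\in\Gamma_0\}$. The resulting affine structure on $\Delta^{\pitchfork}$ does not depend on the choice of origin $\Gamma_0$. A regular Jacobi curve is a smooth curve $\Gamma\colon I\to\mathscr{L}(W)$ such that for every $t_0\in I$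 the quadratic form $\dot\Gamma(t_0)$ on $\Gamma(t_0)$, $\dot\Gamma(t_0)(v_0)=\omega(v_0,v'(t_0))$ with $v(t)\in\Gamma(t)$ any smooth curve with $v(t_0)=v_0$ (the value does not depend on this choice), is non-degenerate. For $\Delta\in\Gamma(\tau)^{\pitchfork}$ we have $\Gamma(t)\in\Delta^{\pitchfork}$ for $t$ near $\tau$; $\Gamma_\Delta$ denotes the curve $\Gamma$ (for $t$ near $\tau$) viewed in the affine space $\Delta^{\pitchfork}$, and $\Gamma'_\Delta,\Gamma''_\Delta,\dots$ are its derivatives, taking values in the vector space associated with $\Delta^{\pitchfork}$. *)

theory Defs
  imports "HOL-Analysis.Analysis"
begin

definition symplectic_form :: "('a::euclidean_space \<Rightarrow> 'a \<Rightarrow> real) \<Rightarrow> bool" where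
  "symplectic_form \<omega> \<longleftrightarrow>
     bilinear \<omega> \<and> (\<forall>v. \<omega> v v = 0) \<and> (\<forall>u. (\<forall>v. \<omega> u v = 0) \<longrightarrow> u = 0)"

definition lagrangian_grassmannian ::
    "('a::euclidean_space \<Rightarrow> 'a \<Rightarrow> real) \<Rightarrow> 'a set set" where
  "lagrangian_grassmannian \<omega> = {L. subspace L \<and> {v. \<forall>u\<in>L. \<omega> u v = 0} = L}"

definition transversals ::
    "('a::euclidean_space \<Rightarrow> 'a \<Rightarrow> real) \<Rightarrow> 'a set \<Rightarrow> 'a set set" where
  "transversals \<omega> \<Lambda> = {\<Gamma> \<in> lagrangian_grassmannian \<omega>. \<Gamma> \<inter> \<Lambda> = {0}}"

text \<open>The linear map from \<open>\<Gamma>0\<close> to \<open>\<Delta>\<close> whose graph is \<open>\<Gamma>\<close>,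
  for \<open>\<Gamma>0\<close> and \<open>\<Gamma>\<close> transversal to \<open>\<Delta>\<close>.\<close>

definition graph_map :: "'a::euclidean_space set \<Rightarrow> 'a set \<Rightarrow> 'a set \<Rightarrow> 'a \<Rightarrow> 'a" where
  "graph_map \<Gamma>0 \<Gamma> \<Delta> = (\<lambda>v\<in>\<Gamma>0. THE w. w \<in> \<Delta> \<and> v + w \<in> \<Gamma>)"

definition nth_vderiv :: "nat \<Rightarrow> (real \<Rightarrow> 'a::real_normed_vector) \<Rightarrow> real \<Rightarrow> 'a" where
  "nth_vderiv k f = ((\<lambda>g t. vector_derivative g (at t)) ^^ k) f"

definition smooth_curve_on :: "real set \<Rightarrow> (real \<Rightarrow> 'a::real_normed_vector) \<Rightarrow> bool" where
  "smooth_curve_on J f \<longleftrightarrow> (\<forall>k. \<forall>t\<in>J. nth_vderiv k f differentiable (at t))"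

text \<open>Smoothness with respect to the atlas of the Lagrangian Grassmannian formed by the charts
  \<open>\<Gamma> \<mapsto> graph_map \<Gamma>0 \<Gamma> \<Delta>\<close> with domain \<open>transversals \<omega> \<Delta>\<close>, for all transversal pairs
  \<open>\<Gamma>0\<close>, \<open>\<Delta>\<close>. A curve in the finite-dimensional space of linear maps from \<open>\<Gamma>0\<close> to \<open>\<Delta>\<close> is
  differentiated by differentiating its values at each vector of \<open>\<Gamma>0\<close>.\<close>

definition smooth_lagrangian_curve ::
    "('a::euclidean_space \<Rightarrow> 'a \<Rightarrow> real) \<Rightarrow> real set \<Rightarrow> (real \<Rightarrow> 'a set) \<Rightarrow> bool" where
  "smooth_lagrangian_curve \<omega> I \<Gamma> \<longleftrightarrow>
     (\<forall>t\<in>I. \<Gamma> t \<in> lagrangian_grassmannian \<omega>) \<and>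
     (\<forall>t0\<in>I. \<exists>\<Delta>\<in>lagrangian_grassmannian \<omega>. \<exists>\<Gamma>0\<in>transversals \<omega> \<Delta>. \<exists>J.
        open J \<and> t0 \<in> J \<and> J \<subseteq> I \<and> (\<forall>t\<in>J. \<Gamma> t \<in> transversals \<omega> \<Delta>) \<and>
        (\<forall>v\<in>\<Gamma>0. smooth_curve_on J (\<lambda>t. graph_map \<Gamma>0 (\<Gamma> t) \<Delta> v)))"

text \<open>The quadratic form given by the velocity of \<open>\<Gamma>\<close> at \<open>t0\<close>.\<close>

definition velocity_form ::
    "('a::euclidean_space \<Rightarrow> 'a \<Rightarrow> real) \<Rightarrow> real set \<Rightarrow> (real \<Rightarrow> 'a set) \<Rightarrow> real \<Rightarrow> 'a \<Rightarrow> real" where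
  "velocity_form \<omega> I \<Gamma> t0 v0 =
     (THE q. \<exists>v J. open J \<and> t0 \<in> J \<and> J \<subseteq> I \<and> smooth_curve_on J v \<and> (\<forall>t\<in>J. v t \<in> \<Gamma> t) \<and>
        v t0 = v0 \<and> q = \<omega> v0 (vector_derivative v (at t0)))"

text \<open>Non-degeneracy of a quadratic form is that of its polar form.\<close>

definition nondegenerate_quadratic_form_on ::
    "'a::real_vector set \<Rightarrow> ('a \<Rightarrow> real) \<Rightarrow> bool" where
  "nondegenerate_quadratic_form_on V Q \<longleftrightarrow>
     (\<forall>u\<in>V. (\<forall>v\<in>V. Q (u + v) - Q u - Q v = 0) \<longrightarrow> u = 0)"

definition regular_jacobi_curve ::
    "('a::euclidean_space \<Rightarrow> 'a \<Rightarrow> real) \<Rightarrow> real set \<Rightarrow> (real \<Rightarrow> 'a set) \<Rightarrow> bool" where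
  "regular_jacobi_curve \<omega> I \<Gamma> \<longleftrightarrow> smooth_lagrangian_curve \<omega> I \<Gamma> \<and>
     (\<forall>t0\<in>I. nondegenerate_quadratic_form_on (\<Gamma> t0) (velocity_form \<omega> I \<Gamma> t0))"

text \<open>The \<open>k\<close>-th derivative at \<open>t\<close> of \<open>\<Gamma>\<close>, viewed in the affine space \<open>transversals \<omega> \<Delta>\<close> with
  origin \<open>\<Gamma>0\<close>, as a linear map from \<open>\<Gamma>0\<close> to \<open>\<Delta>\<close>. It depends only on \<open>\<Gamma>\<close> near \<open>t\<close>.\<close>

definition affine_nth_deriv ::
    "nat \<Rightarrow> 'a::euclidean_space set \<Rightarrow> 'a set \<Rightarrow> (real \<Rightarrow> 'a set) \<Rightarrow> real \<Rightarrow> 'a \<Rightarrow> 'a" where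
  "affine_nth_deriv k \<Gamma>0 \<Delta> \<Gamma> t v = nth_vderiv k (\<lambda>s. graph_map \<Gamma>0 (\<Gamma> s) \<Delta> v) t"

end

theory Submission
  imports Defs
begin

text \<open>The chart \<open>graph_map \<Gamma>0 \<Gamma> \<Delta>\<close> is \<open>v \<mapsto> p v - v\<close> for the projection \<open>p\<close> onto \<open>\<Gamma>\<close> along
  \<open>\<Delta>\<close>, so the derivatives of a curve in the affine space of \<open>\<Delta>\<close> are those of \<open>t \<mapsto> p t\<close> and do not
  see the origin \<open>\<Gamma>0\<close>. Fix a chart \<open>\<Delta>0\<close> around \<open>L = \<Gamma> \<tau>\<close> and let \<open>A\<close>, \<open>A2\<close> be the first two
  derivatives at \<open>\<tau>\<close> of the projection along \<open>\<Delta>0\<close>; both map \<open>L\<close> to \<open>\<Delta>0\<close>. For another transversal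
  \<open>\<Delta>\<close>, with \<open>q\<close> the projection onto \<open>L\<close> along \<open>\<Delta>\<close>, the second derivative along \<open>\<Delta>\<close> is
  \<open>(1 - q) (A2 - 2 A q A)\<close> on \<open>L\<close>. Regularity makes \<open>A\<close> an isomorphism of \<open>L\<close> onto \<open>\<Delta>0\<close>, so this
  vanishes iff \<open>q\<close> equals \<open>1/2 A\<^sup>-\<^sup>1 A2 A\<^sup>-\<^sup>1\<close> on \<open>\<Delta>0\<close>, which determines \<open>\<Delta> = ker q\<close>; the symmetry of
  \<open>A\<close> and \<open>A2\<close> makes the resulting \<open>\<Delta>\<close> Lagrangian.\<close>

section \<open>Complementary subspaces and the projection along one of them\<close>

definition complementary :: "'a::real_vector set \<Rightarrow> 'a set \<Rightarrow> bool" where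
  "complementary S T \<longleftrightarrow> subspace S \<and> subspace T \<and> S \<inter> T = {0} \<and>
     (\<forall>x. \<exists>s\<in>S. x - s \<in> T)"

definition proj_along :: "'a::real_vector set \<Rightarrow> 'a set \<Rightarrow> 'a \<Rightarrow> 'a" where
  "proj_along S T x = (THE s. s \<in> S \<and> x - s \<in> T)"

text \<open>Two candidates for the projection of \<open>x\<close> differ by an element of
  \<open>S \<inter> T\<close>.\<close>

lemma proj_along_eqI:
  assumes "complementary S T" "s \<in> S" "x - s \<in> T"
  shows "proj_along S T x = s"
  unfolding proj_along_def
proof (rule the_equality)
  fix r assume r: "r \<in> S \<and> x - r \<in> T"
  have "r - s \<in> S" "(x - s) - (x - r) \<in> T"
    using assms r unfolding complementary_def by (metis subspace_diff)+
  then have "r - s \<in> S \<inter> T" by simp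
  then show "r = s" using assms(1) unfolding complementary_def by auto
qed (use assms in auto)

lemma
  assumes "complementary S T"
  shows proj_along_in: "proj_along S T x \<in> S"
    and proj_along_compl: "x - proj_along S T x \<in> T"
proof -
  obtain s where "s \<in> S" "x - s \<in> T" using assms by (auto simp: complementary_def)
  then show "proj_along S T x \<in> S" "x - proj_along S T x \<in> T"
    using proj_along_eqI[OF assms] by auto
qed

lemma proj_along_ident: "complementary S T \<Longrightarrow> x \<in> S \<Longrightarrow> proj_along S T x = x"
  by (rule proj_along_eqI) (auto simp: complementary_def subspace_0)

lemma proj_along_eq_0_iff: "complementary S T \<Longrightarrow> proj_along S T x = 0 \<longleftrightarrow> x \<in> T"
  using proj_along_compl[of S T x] proj_along_eqI[of S T 0 x]
  by (auto simp: complementary_def subspace_0)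

lemma linear_proj_along:
  assumes "complementary S T"
  shows "linear (proj_along S T)"
proof (rule linearI)
  have sub: "subspace S" "subspace T" using assms by (auto simp: complementary_def)
  note p = proj_along_in[OF assms] proj_along_compl[OF assms]
  show "proj_along S T (x + y) = proj_along S T x + proj_along S T y" for x y
  proof (rule proj_along_eqI[OF assms])
    have "(x - proj_along S T x) + (y - proj_along S T y) \<in> T"
      using p sub by (intro subspace_add) auto
    then show "x + y - (proj_along S T x + proj_along S T y) \<in> T" by (simp add: algebra_simps)
  qed (use p sub in \<open>auto intro: subspace_add\<close>)
  show "proj_along S T (c *\<^sub>R x) = c *\<^sub>R proj_along S T x" for c x
  proof (rule proj_along_eqI[OF assms])
    show "c *\<^sub>R x - c *\<^sub>R proj_along S T x \<in> T"
      using subspace_scale[OF sub(2) p(2), of c x] by (simp add: algebra_simps)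
  qed (use p sub in \<open>auto intro: subspace_scale\<close>)
qed

text \<open>Moving \<open>v\<close> within its coset of \<open>\<Delta>\<close> until it meets
  \<open>\<Gamma>\<close> is projecting it along \<open>\<Delta>\<close>. The map on
  \<open>\<Gamma>0\<close> is thus the restriction of a linear map of the whole space that does not
  involve \<open>\<Gamma>0\<close>.\<close>

lemma graph_map_eq_proj_along:
  fixes \<Gamma> \<Delta> :: "'a::euclidean_space set"
  assumes "complementary \<Gamma> \<Delta>" "v \<in> \<Gamma>0"
  shows "graph_map \<Gamma>0 \<Gamma> \<Delta> v = proj_along \<Gamma> \<Delta> v - v"
proof -
  have sub: "subspace \<Delta>" using assms by (auto simp: complementary_def)
  have "(THE w. w \<in> \<Delta> \<and> v + w \<in> \<Gamma>) = proj_along \<Gamma> \<Delta> v - v"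
  proof (rule the_equality)
    show "proj_along \<Gamma> \<Delta> v - v \<in> \<Delta> \<and> v + (proj_along \<Gamma> \<Delta> v - v) \<in> \<Gamma>"
      using proj_along_in[OF assms(1), of v] subspace_neg[OF sub proj_along_compl[OF assms(1), of v]]
      by simp
  next
    fix w assume w: "w \<in> \<Delta> \<and> v + w \<in> \<Gamma>"
    have "proj_along \<Gamma> \<Delta> v = v + w"
      by (rule proj_along_eqI[OF assms(1)]) (use w subspace_neg[OF sub, of w] in auto)
    then show "w = proj_along \<Gamma> \<Delta> v - v" by simp
  qed
  then show ?thesis using assms(2) by (simp add: graph_map_def)
qed

section \<open>Lagrangian subspaces\<close>

lemma symplectic_skew:
  assumes "symplectic_form \<omega>"
  shows "\<omega> x y = - \<omega> y x"
proof -
  have b: "bilinear \<omega>" and z: "\<omega> (x + y) (x + y) = 0" "\<omega> x x = 0" "\<omega> y y = 0"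
    using assms by (auto simp: symplectic_form_def)
  show ?thesis using z by (simp add: bilinear_ladd[OF b] bilinear_radd[OF b])
qed

lemma lagrangian_isotropic:
  "L \<in> lagrangian_grassmannian \<omega> \<Longrightarrow> x \<in> L \<Longrightarrow> y \<in> L \<Longrightarrow> \<omega> x y = 0"
  by (auto simp: lagrangian_grassmannian_def)

lemma lagrangian_dim:
  fixes \<omega> :: "'a::euclidean_space \<Rightarrow> 'a \<Rightarrow> real"
  assumes sym: "symplectic_form \<omega>" and L: "L \<in> lagrangian_grassmannian \<omega>"
  shows "2 * dim L = DIM('a)"
proof -
  have b: "bilinear \<omega>" and nd: "\<And>u. (\<forall>v. \<omega> u v = 0) \<Longrightarrow> u = 0"
    using sym by (auto simp: symplectic_form_def)
  have sub: "subspace L" and orth: "{v. \<forall>u\<in>L. \<omega> u v = 0} = L"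
    using L by (auto simp: lagrangian_grassmannian_def)
  define J where "J u = (\<Sum>b\<in>Basis. \<omega> u b *\<^sub>R b)" for u
  have J: "J u \<bullet> v = \<omega> u v" for u v
  proof -
    have lin: "linear (\<omega> u)" using b by (simp add: bilinear_def)
    have "\<omega> u v = \<omega> u (\<Sum>b\<in>Basis. (v \<bullet> b) *\<^sub>R b)" by (simp add: euclidean_representation)
    also have "\<dots> = (\<Sum>b\<in>Basis. (v \<bullet> b) * \<omega> u b)"
      by (simp add: linear_sum[OF lin] linear_cmul[OF lin])
    also have "\<dots> = (\<Sum>b\<in>Basis. \<omega> u b * (b \<bullet> v))" by (simp add: inner_commute mult.commute)
    finally show ?thesis by (simp add: J_def inner_sum_left)
  qed
  have lin: "linear J"
    by (rule linearI; rule vector_eq_ldot[THEN iffD1])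
       (auto simp: J inner_commute[of _ "J _"] inner_add_left inner_left_distrib
         bilinear_ladd[OF b] bilinear_lmul[OF b] inner_right_distrib)
  have inj: "inj J"
  proof (rule injI)
    fix x y assume "J x = J y"
    then have "\<omega> (x - y) v = 0" for v
      using J[of x v] J[of y v] by (simp add: bilinear_lsub[OF b])
    then show "x = y" using nd[of "x - y"] by simp
  qed
  have "{v \<in> UNIV. \<forall>x\<in>J ` L. orthogonal x v} = L"
    using orth by (auto simp: orthogonal_def J)
  moreover have "subspace (J ` L)" using lin sub by (rule linear_subspace_image)
  ultimately have "dim L + dim (J ` L) = DIM('a)"
    using dim_subspace_orthogonal_to_vectors[of "J ` L" UNIV] by (simp add: dim_UNIV)
  moreover have "dim (J ` L) = dim L"
    by (rule dim_image_eq[OF lin]) (use inj in \<open>auto intro: inj_on_subset\<close>)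
  ultimately show ?thesis by simp
qed

text \<open>Two half-dimensional subspaces with trivial intersection span the whole space.\<close>

lemma lagrangian_complementary:
  fixes \<omega> :: "'a::euclidean_space \<Rightarrow> 'a \<Rightarrow> real"
  assumes sym: "symplectic_form \<omega>"
    and S: "S \<in> lagrangian_grassmannian \<omega>" and T: "T \<in> lagrangian_grassmannian \<omega>"
    and int: "S \<inter> T = {0}"
  shows "complementary S T"
proof -
  have sub: "subspace S" "subspace T"
    using S T by (auto simp: lagrangian_grassmannian_def)
  have "dim {x + y |x y. x \<in> S \<and> y \<in> T} = DIM('a)"
    using dim_sums_Int[OF sub] lagrangian_dim[OF sym S] lagrangian_dim[OF sym T] int by simp
  moreover have "subspace {x + y |x y. x \<in> S \<and> y \<in> T}" using sub by (rule subspace_sums)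
  ultimately have "{x + y |x y. x \<in> S \<and> y \<in> T} = UNIV"
    using dim_eq_full[of "{x + y |x y. x \<in> S \<and> y \<in> T}"]
      span_eq_iff[of "{x + y |x y. x \<in> S \<and> y \<in> T}"] by simp
  then have sums: "x \<in> {x + y |x y. x \<in> S \<and> y \<in> T}" for x by simp
  have "\<exists>s\<in>S. x - s \<in> T" for x
  proof -
    obtain s t where "x = s + t" "s \<in> S" "t \<in> T" using sums[of x] by blast
    then show ?thesis by (intro bexI[of _ s]) auto
  qed
  then show ?thesis using sub int by (simp add: complementary_def)
qed

section \<open>Differentiation of families of linear maps and of solutions of linear
  equations\<close>

lemma linear_Basis_expansion:
  fixes A :: "'a::euclidean_space \<Rightarrow> 'b::real_vector"
  assumes "linear A"
  shows "A x = (\<Sum>b\<in>Basis. (x \<bullet> b) *\<^sub>R A b)"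
proof -
  have "A x = A (\<Sum>b\<in>Basis. (x \<bullet> b) *\<^sub>R b)" by (simp add: euclidean_representation)
  also have "\<dots> = (\<Sum>b\<in>Basis. (x \<bullet> b) *\<^sub>R A b)"
    by (simp add: linear_sum[OF assms] linear_cmul[OF assms])
  finally show ?thesis .
qed

text \<open>Product rule for a moving operator applied to a moving vector. Expansion in the basis
  reduces it to finitely many products of a scalar and a vector, so pointwise derivatives of the
  family suffice.\<close>

lemma has_vector_derivative_linear_family:
  fixes A :: "real \<Rightarrow> 'a::euclidean_space \<Rightarrow> 'b::real_normed_vector"
  assumes S: "open S" "s \<in> S" and lin: "\<And>t. t \<in> S \<Longrightarrow> linear (A t)" and lin': "linear A'"
    and A: "\<And>z. ((\<lambda>t. A t z) has_vector_derivative A' z) (at s)"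
    and x: "(x has_vector_derivative x') (at s)"
  shows "((\<lambda>t. A t (x t)) has_vector_derivative A' (x s) + A s x') (at s)"
proof -
  have "((\<lambda>t. \<Sum>b\<in>Basis. (x t \<bullet> b) *\<^sub>R A t b) has_vector_derivative
      (\<Sum>b\<in>Basis. (x s \<bullet> b) *\<^sub>R A' b + (x' \<bullet> b) *\<^sub>R A s b)) (at s)"
  proof (rule has_vector_derivative_sum)
    fix b :: 'a
    have "((\<lambda>t. x t \<bullet> b) has_vector_derivative x' \<bullet> b) (at s)"
      by (rule bounded_linear.has_vector_derivative[OF bounded_linear_inner_left x])
    then show "((\<lambda>t. (x t \<bullet> b) *\<^sub>R A t b) has_vector_derivative
        (x s \<bullet> b) *\<^sub>R A' b + (x' \<bullet> b) *\<^sub>R A s b) (at s)"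
      using has_vector_derivative_scaleR[OF _ A]
      by (simp add: has_real_derivative_iff_has_vector_derivative)
  qed
  then have "((\<lambda>t. \<Sum>b\<in>Basis. (x t \<bullet> b) *\<^sub>R A t b) has_vector_derivative
      A' (x s) + A s x') (at s)"
    using linear_Basis_expansion[OF lin', of "x s"] linear_Basis_expansion[OF lin[OF S(2)], of x']
    by (simp add: sum.distrib)
  then show ?thesis
    by (rule has_vector_derivative_transform_within_open[OF _ S])
       (use lin linear_Basis_expansion in \<open>metis\<close>)
qed

text \<open>By continuity \<open>N t\<close> stays within operator distance 1/2 of the identity near
  \<open>s\<close>. The bound gives injectivity of \<open>N t\<close> and controls its inverse
  uniformly in \<open>t\<close>.\<close>

lemma linear_family_bounded_below:
  fixes N :: "real \<Rightarrow> 'a::euclidean_space \<Rightarrow> 'a"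
  assumes S: "open S" "s \<in> S" and lin: "\<And>t. t \<in> S \<Longrightarrow> linear (N t)"
    and id: "\<And>z. N s z = z" and cont: "\<And>z. isCont (\<lambda>t. N t z) s"
  obtains V where "open V" "s \<in> V" "V \<subseteq> S"
    "\<And>t z. t \<in> V \<Longrightarrow> norm z \<le> 2 * norm (N t z)"
proof -
  \<comment> \<open>This finite sum dominates the operator norm of \<open>N t - id\<close> and is
    visibly continuous in \<open>t\<close>.\<close>
  define \<phi> where "\<phi> t = (\<Sum>b\<in>Basis. norm (N t b - b))" for t
  have "isCont \<phi> s" unfolding \<phi>_def by (intro continuous_intros cont)
  moreover have "\<phi> s = 0" by (simp add: \<phi>_def id)
  ultimately have "(\<phi> \<longlongrightarrow> 0) (nhds s)"
    by (metis continuous_at tendsto_at_iff_tendsto_nhds)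
  then have "\<forall>\<^sub>F t in nhds s. \<phi> t < 1/2" by (rule order_tendstoD) simp
  then obtain V where V: "open V" "s \<in> V" "\<And>t. t \<in> V \<Longrightarrow> \<phi> t < 1/2"
    by (auto simp: eventually_nhds)
  have "norm z \<le> 2 * norm (N t z)" if "t \<in> V \<inter> S" for t z
  proof -
    have "linear (\<lambda>z. N t z - z)" using lin that by (intro linear_compose_sub linear_ident) auto
    from linear_Basis_expansion[OF this, of z]
    have "norm (N t z - z) \<le> (\<Sum>b\<in>Basis. norm z * norm (N t b - b))"
      by (auto intro!: sum_norm_le mult_right_mono Basis_le_norm)
    also have "\<dots> = norm z * \<phi> t" by (simp add: \<phi>_def sum_distrib_left)
    also have "\<dots> \<le> norm z * (1/2)" using V(3)[of t] that by (intro mult_left_mono) auto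
    finally show ?thesis using norm_triangle_ineq2[of z "z - N t z"]
      by (simp add: norm_minus_commute)
  qed
  then show ?thesis using that[of "V \<inter> S"] V S by auto
qed

text \<open>The remainder is divided by \<open>t - s\<close>; the value of the quotient at
  \<open>t = s\<close> is invisible to the filter \<open>at s\<close>.\<close>

lemma has_vector_derivative_iff_quotient:
  "(f has_vector_derivative f') (at s) \<longleftrightarrow>
     ((\<lambda>t. (1 / (t - s)) *\<^sub>R (f t - f s)) \<longlongrightarrow> f') (at s)" (is "_ \<longleftrightarrow> ?R")
proof -
  have "(f has_vector_derivative f') (at s) \<longleftrightarrow>
      ((\<lambda>t. norm (f t - f s - (t - s) *\<^sub>R f') / norm (t - s)) \<longlongrightarrow> 0) (at s)"
    by (simp add: has_vector_derivative_def has_derivative_iff_norm bounded_linear_scaleR_left)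
  also have "\<dots> \<longleftrightarrow> ((\<lambda>t. norm ((1 / (t - s)) *\<^sub>R (f t - f s) - f')) \<longlongrightarrow> 0) (at s)"
  proof (rule filterlim_cong[OF refl refl])
    have "norm (f t - f s - (t - s) *\<^sub>R f') / norm (t - s) = norm ((1 / (t - s)) *\<^sub>R (f t - f s) - f')"
      if "t \<noteq> s" for t
    proof -
      have "(1 / (t - s)) *\<^sub>R (f t - f s) - f' = (1 / (t - s)) *\<^sub>R (f t - f s - (t - s) *\<^sub>R f')"
        using that by (simp add: scaleR_diff_right)
      then show ?thesis by simp
    qed
    then show "\<forall>\<^sub>F t in at s. norm (f t - f s - (t - s) *\<^sub>R f') / norm (t - s) =
        norm ((1 / (t - s)) *\<^sub>R (f t - f s) - f')"
      by (simp add: eventually_at_filter)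
  qed
  also have "\<dots> \<longleftrightarrow> ?R"
    by (simp only: tendsto_norm_zero_iff LIM_zero_iff)
  finally show ?thesis .
qed

text \<open>Differentiability of the solution \<open>x\<close> is a conclusion here. The error of
  its difference quotient is sent by \<open>N t\<close> to a quantity tending to 0, and the lower
  bound on \<open>N t\<close> carries this back to the error itself.\<close>

lemma has_vector_derivative_linear_solution:
  fixes N :: "real \<Rightarrow> 'a::euclidean_space \<Rightarrow> 'a"
  assumes S: "open S" "s \<in> S" and lin: "\<And>t. t \<in> S \<Longrightarrow> linear (N t)"
    and below: "\<And>t z. t \<in> S \<Longrightarrow> norm z \<le> 2 * norm (N t z)"
    and N: "\<And>z. ((\<lambda>t. N t z) has_vector_derivative N' z) (at s)"
    and r: "(r has_vector_derivative r') (at s)"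
    and sol: "\<And>t. t \<in> S \<Longrightarrow> N t (x t) = r t"
    and d: "N s d = r' - N' (x s)"
  shows "(x has_vector_derivative d) (at s)"
proof -
  define h where "h t = (1 / (t - s)) *\<^sub>R (x t - x s)" for t
  \<comment> \<open>This is \<open>N t (h t - d)\<close> with \<open>x t\<close> eliminated by means
    of the equations at \<open>t\<close> and at \<open>s\<close>.\<close>
  define k where "k t = (1 / (t - s)) *\<^sub>R (r t - r s)
      - (1 / (t - s)) *\<^sub>R (N t (x s) - N s (x s)) - N t d" for t
  have "isCont (\<lambda>t. N t d) s" using N has_vector_derivative_continuous by blast
  then have "(k \<longlongrightarrow> r' - N' (x s) - N s d) (at s)"
    unfolding k_def by (intro tendsto_intros r[unfolded has_vector_derivative_iff_quotient] N[unfolded has_vector_derivative_iff_quotient]) (simp add: continuous_at)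
  then have k0: "(k \<longlongrightarrow> 0) (at s)" by (simp add: d)
  have S': "\<forall>\<^sub>F t in at s. t \<in> S \<and> t \<noteq> s"
    using S by (auto simp: eventually_at_topological)
  have "\<forall>\<^sub>F t in at s. norm (h t - d) \<le> norm (2 *\<^sub>R k t)"
    using S'
  proof eventually_elim
    case (elim t)
    note l = lin[of t]
    have "N t (h t - d) = k t"
      using elim sol[of t] sol[OF S(2)]
      by (simp add: h_def k_def linear_diff[OF l] linear_cmul[OF l] scaleR_diff_right)
    then show ?case using below[of t "h t - d"] elim by simp
  qed
  moreover have "((\<lambda>t. norm (2 *\<^sub>R k t)) \<longlongrightarrow> 0) (at s)"
    using tendsto_norm[OF tendsto_scaleR[OF tendsto_const k0, of 2]] by simp
  ultimately have "((\<lambda>t. h t - d) \<longlongrightarrow> 0) (at s)"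
    by (rule Lim_null_comparison)
  then have "(h \<longlongrightarrow> d) (at s)" by (simp add: LIM_zero_iff)
  then show ?thesis unfolding h_def has_vector_derivative_iff_quotient .
qed

text \<open>Both sides of each linearity law are derivatives of the same curve, and derivatives are
  unique.\<close>

lemma linear_vector_derivative_family:
  fixes A :: "real \<Rightarrow> 'a::real_vector \<Rightarrow> 'b::real_normed_vector"
  assumes S: "open S" "s \<in> S" and lin: "\<And>t. t \<in> S \<Longrightarrow> linear (A t)"
    and A: "\<And>z. ((\<lambda>t. A t z) has_vector_derivative A' z) (at s)"
  shows "linear A'"
proof (rule linearI)
  show "A' (x + y) = A' x + A' y" for x y
  proof (rule vector_derivative_unique_at[OF A])
    show "((\<lambda>t. A t (x + y)) has_vector_derivative A' x + A' y) (at s)"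
      by (rule has_vector_derivative_transform_within_open[OF has_vector_derivative_add[OF A A] S])
         (simp add: linear_add[OF lin])
  qed
  show "A' (c *\<^sub>R x) = c *\<^sub>R A' x" for c x
  proof (rule vector_derivative_unique_at[OF A])
    show "((\<lambda>t. A t (c *\<^sub>R x)) has_vector_derivative c *\<^sub>R A' x) (at s)"
      by (rule has_vector_derivative_transform_within_open
            [OF bounded_linear.has_vector_derivative[OF bounded_linear_scaleR_right A] S])
         (simp add: linear_cmul[OF lin])
  qed
qed

text \<open>Serves to differentiate identities that hold along a curve, such as isotropy.\<close>

lemma has_vector_derivative_zero_on_open:
  assumes "open S" "s \<in> S" "\<And>t. t \<in> S \<Longrightarrow> f t = c" "(f has_vector_derivative d) (at s)"
  shows "d = 0"
proof (rule vector_derivative_unique_at[OF assms(4)])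
  show "(f has_vector_derivative 0) (at s)"
    by (rule has_vector_derivative_transform_within_open[OF has_vector_derivative_const assms(1,2)])
       (simp add: assms(3))
qed

section \<open>Second derivative of the projection along another transversal\<close>

text \<open>For \<open>x = proj_along (\<Gamma> t) \<Delta> z\<close> and \<open>B t = proj_along (\<Gamma> t) \<Delta>0 - proj_along (\<Gamma> \<tau>) \<Delta>0\<close>, the
  vector \<open>f t = B t x\<close> solves the linear equation \<open>f t + B t (q (f t)) = B t (q z)\<close>, whose operator
  is the identity at \<open>\<tau>\<close>, and \<open>x = q z + f t - q (f t)\<close>. Differentiating the equation twice gives
  the formula.\<close>

lemma proj_along_second_derivative:
  fixes \<Gamma> :: "real \<Rightarrow> 'a::euclidean_space set"
  assumes J: "open J" "\<tau> \<in> J"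
    and c0: "\<And>t. t \<in> J \<Longrightarrow> complementary (\<Gamma> t) \<Delta>0"
    and c\<tau>: "complementary (\<Gamma> \<tau>) \<Delta>"
    and c: "\<And>t. t \<in> J \<Longrightarrow> \<Gamma> t \<inter> \<Delta> = {0} \<Longrightarrow> complementary (\<Gamma> t) \<Delta>"
    and E1: "\<And>t z. t \<in> J \<Longrightarrow>
      ((\<lambda>t. proj_along (\<Gamma> t) \<Delta>0 z) has_vector_derivative E1 t z) (at t)"
    and E2: "\<And>z. ((\<lambda>t. E1 t z) has_vector_derivative E2 z) (at \<tau>)"
  defines "q \<equiv> proj_along (\<Gamma> \<tau>) \<Delta>"
  defines "X \<equiv> \<lambda>z. E2 (q z) - 2 *\<^sub>R E1 \<tau> (q (E1 \<tau> (q z)))"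
  obtains V F1 where "open V" "\<tau> \<in> V" "V \<subseteq> J" "\<And>t. t \<in> V \<Longrightarrow> complementary (\<Gamma> t) \<Delta>"
    "\<And>t z. t \<in> V \<Longrightarrow> ((\<lambda>t. proj_along (\<Gamma> t) \<Delta> z) has_vector_derivative F1 t z) (at t)"
    "\<And>z. ((\<lambda>t. F1 t z) has_vector_derivative X z - q (X z)) (at \<tau>)"
proof -
  define E where "E t = proj_along (\<Gamma> t) \<Delta>0" for t
  define B where "B t z = E t z - E \<tau> z" for t z
  define N where "N t x = x + B t (q x)" for t x
  have linq: "linear q" unfolding q_def by (rule linear_proj_along[OF c\<tau>])
  have blq: "bounded_linear q" using linq by (rule linear_conv_bounded_linear[THEN iffD1])
  have linE: "linear (E t)" if "t \<in> J" for t
    unfolding E_def by (rule linear_proj_along[OF c0[OF that]])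
  have linB: "linear (B t)" if "t \<in> J" for t
    unfolding B_def using linE[OF that] linE[OF J(2)] by (intro linear_compose_sub)
  have linN: "linear (N t)" if "t \<in> J" for t
    unfolding N_def using linear_compose[OF linq linB[OF that]]
    by (intro linear_compose_add linear_ident) (simp add: o_def)
  have dE: "((\<lambda>t. E t z) has_vector_derivative E1 t z) (at t)" if "t \<in> J" for t z
    unfolding E_def using E1[OF that] .
  have dB: "((\<lambda>t. B t z) has_vector_derivative E1 t z) (at t)" if "t \<in> J" for t z
    unfolding B_def using has_vector_derivative_diff[OF dE[OF that] has_vector_derivative_const]
    by simp
  have dN: "((\<lambda>t. N t z) has_vector_derivative E1 t (q z)) (at t)" if "t \<in> J" for t z
    unfolding N_def using has_vector_derivative_add[OF has_vector_derivative_const dB[OF that]]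
    by simp
  have linE1: "linear (E1 t)" if "t \<in> J" for t
    by (rule linear_vector_derivative_family[OF J(1) that linE dE[OF that]])
  have linE2: "linear E2"
    by (rule linear_vector_derivative_family[OF J linE1 E2])
  have B\<tau>: "B \<tau> z = 0" for z by (simp add: B_def)
  have N\<tau>: "N \<tau> z = z" for z by (simp add: N_def B\<tau>)
  have contN: "isCont (\<lambda>t. N t z) \<tau>" for z
    using dN[OF J(2)] has_vector_derivative_continuous by blast
  obtain V where V: "open V" "\<tau> \<in> V" "V \<subseteq> J"
    and below: "\<And>t z. t \<in> V \<Longrightarrow> norm z \<le> 2 * norm (N t z)"
    using linear_family_bounded_below[OF J linN N\<tau> contN] by blast
  have VJ: "t \<in> J" if "t \<in> V" for t using V that by auto
  have kerN: "x = 0" if "t \<in> V" "N t x = 0" for t x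
    using below[OF that(1), of x] that(2) by simp
  have injN: "inj (N t)" if "t \<in> V" for t
    unfolding linear_injective_0[OF linN[OF VJ[OF that]]] using kerN[OF that] by auto
  have surjN: "surj (N t)" if "t \<in> V" for t
    by (rule linear_injective_imp_surjective[OF linN[OF VJ[OF that]] injN[OF that]]) simp
  define sol where "sol t y = inv (N t) y" for t y
  have sol: "N t (sol t y) = y" if "t \<in> V" for t y
    unfolding sol_def by (rule surj_f_inv_f[OF surjN[OF that]])

  define f where "f z t = sol t (B t (q z))" for z t
  \<comment> \<open>Formal differentiation of \<open>N t (f z t) = B t (q z)\<close> predicts this
    derivative of \<open>f z\<close>; \<open>df\<close> confirms it.\<close>
  define f1 where "f1 z t = sol t (E1 t (q z) - E1 t (q (f z t)))" for z t
  have Nf: "N t (f z t) = B t (q z)" if "t \<in> V" for z t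
    unfolding f_def by (rule sol[OF that])
  have Nf1: "N t (f1 z t) = E1 t (q z) - E1 t (q (f z t))" if "t \<in> V" for z t
    unfolding f1_def by (rule sol[OF that])
  have f\<tau>: "f z \<tau> = 0" for z using Nf[OF V(2), of z] by (simp add: N\<tau> B\<tau>)
  have f1\<tau>: "f1 z \<tau> = E1 \<tau> (q z)" for z
    using Nf1[OF V(2), of z]
    by (simp add: N\<tau> f\<tau> linear_0[OF linq] linear_0[OF linE1[OF J(2)]])
  have df: "(f z has_vector_derivative f1 z t) (at t)" if t: "t \<in> V" for z t
    by (rule has_vector_derivative_linear_solution
          [OF V(1) t linN[OF VJ] below dN[OF VJ[OF t]] dB[OF VJ[OF t]] Nf Nf1[OF t]])
  \<comment> \<open>At \<open>\<tau>\<close> the vector \<open>f z \<tau>\<close> vanishes, and the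
    derivatives of the operator and of the right-hand side contribute the same cross term, whence
    the factor 2 in \<open>X\<close>.\<close>
  have df1: "(f1 z has_vector_derivative X z) (at \<tau>)" for z
  proof (rule has_vector_derivative_linear_solution
          [OF V(1,2) linN[OF VJ] below dN[OF J(2)] _ Nf1])
    show "((\<lambda>t. E1 t (q z) - E1 t (q (f z t))) has_vector_derivative
        E2 (q z) - (E2 (q (f z \<tau>)) + E1 \<tau> (q (f1 z \<tau>)))) (at \<tau>)"
      by (intro has_vector_derivative_diff E2
          has_vector_derivative_linear_family[OF J linE1 linE2 E2]
          bounded_linear.has_vector_derivative[OF blq df[OF V(2)]])
    show "N \<tau> (X z) = E2 (q z) - (E2 (q (f z \<tau>)) + E1 \<tau> (q (f1 z \<tau>))) - E1 \<tau> (q (f1 z \<tau>))"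
      by (simp add: N\<tau> X_def f\<tau> f1\<tau> linear_0[OF linq] linear_0[OF linE2] scaleR_2)
  qed

  \<comment> \<open>For \<open>x\<close> in \<open>\<Gamma> t\<close>, \<open>B t x\<close> is the
    \<open>\<Delta>0\<close>-component of \<open>x\<close> in the splitting by
    \<open>\<Gamma> \<tau>\<close> and \<open>\<Delta>0\<close>. Since \<open>B t\<close> kills
    \<open>\<Delta>0\<close>, it sees only \<open>E \<tau> x\<close>, which equals
    \<open>q x - q (B t x)\<close>.\<close>
  have rel: "N t (B t x) = B t (q x)" "x = q x - q (B t x) + B t x"
    if t: "t \<in> V" and x: "x \<in> \<Gamma> t" for t x
  proof -
    note J' = VJ[OF t]
    have Ex: "E t x = x" unfolding E_def by (rule proj_along_ident[OF c0[OF J'] x])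
    then have xd: "x = E \<tau> x + B t x" by (simp add: B_def)
    have "q (E \<tau> x) = E \<tau> x"
      unfolding q_def E_def by (rule proj_along_ident[OF c\<tau> proj_along_in[OF c0[OF J(2)]]])
    then have qx: "q x = E \<tau> x + q (B t x)"
      using arg_cong[OF xd, of q] by (simp add: linear_add[OF linq])
    show "x = q x - q (B t x) + B t x" using xd qx by simp
    have k: "x - E \<tau> x \<in> \<Delta>0" unfolding E_def by (rule proj_along_compl[OF c0[OF J(2)]])
    have "E s (x - E \<tau> x) = 0" if "s \<in> J" for s
      using k proj_along_eq_0_iff[OF c0[OF that]] by (simp add: E_def)
    then have "B t (x - E \<tau> x) = 0" using J' J(2) by (simp add: B_def)
    then have "B t x = B t (E \<tau> x)" by (simp add: linear_diff[OF linB[OF J']])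
    also have "\<dots> = B t (q x) - B t (q (B t x))"
      using qx by (simp add: linear_add[OF linB[OF J']])
    finally show "N t (B t x) = B t (q x)" unfolding N_def by (simp only: eq_diff_eq)
  qed
  \<comment> \<open>Transversality to \<open>\<Delta>\<close> persists near \<open>\<tau>\<close>:
    on \<open>\<Delta>\<close> the map \<open>q\<close> vanishes, so injectivity of
    \<open>N t\<close> forces \<open>B t x = 0\<close> and then \<open>x = 0\<close>.\<close>
  have compl: "complementary (\<Gamma> t) \<Delta>" if t: "t \<in> V" for t
  proof (rule c[OF VJ[OF t]])
    have sub: "subspace (\<Gamma> t)" "subspace \<Delta>"
      using c0[OF VJ[OF t]] c\<tau> by (auto simp: complementary_def)
    have "x = 0" if x: "x \<in> \<Gamma> t" "x \<in> \<Delta>" for x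
    proof -
      have "q x = 0" using x(2) by (simp add: q_def proj_along_eq_0_iff[OF c\<tau>])
      then have "N t (B t x) = 0"
        using rel(1)[OF t x(1)] by (simp add: linear_0[OF linB[OF VJ[OF t]]])
      then have "B t x = 0" by (rule kerN[OF t])
      then show ?thesis using rel(2)[OF t x(1)] \<open>q x = 0\<close> by (simp add: linear_0[OF linq])
    qed
    then show "\<Gamma> t \<inter> \<Delta> = {0}" using sub by (auto simp: subspace_0)
  qed
  \<comment> \<open>The point \<open>z\<close> and its projection differ by an element of
    \<open>\<Delta>\<close>, the kernel of \<open>q\<close>, so both give the same right-hand side
    in the equation for \<open>f\<close>.\<close>
  have F: "proj_along (\<Gamma> t) \<Delta> z = q z + (f z t - q (f z t))" if t: "t \<in> V" for t z
  proof -
    define x where "x = proj_along (\<Gamma> t) \<Delta> z"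
    have x: "x \<in> \<Gamma> t" "z - x \<in> \<Delta>"
      unfolding x_def by (rule proj_along_in[OF compl[OF t]] proj_along_compl[OF compl[OF t]])+
    have "q (z - x) = 0" using x(2) by (simp add: q_def proj_along_eq_0_iff[OF c\<tau>])
    then have qx: "q x = q z" by (simp add: linear_diff[OF linq])
    then have "N t (B t x) = N t (f z t)" using rel(1)[OF t x(1)] Nf[OF t] by simp
    then have "B t x = f z t" using injN[OF t] by (simp add: inj_eq)
    then show ?thesis using rel(2)[OF t x(1)] qx by (simp add: x_def)
  qed
  show ?thesis
  proof (rule that[of V "\<lambda>t z. f1 z t - q (f1 z t)", OF V compl])
    fix t z assume t: "t \<in> V"
    have "((\<lambda>t. q z + (f z t - q (f z t))) has_vector_derivative
        0 + (f1 z t - q (f1 z t))) (at t)"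
      by (rule has_vector_derivative_add[OF has_vector_derivative_const
          has_vector_derivative_diff[OF df[OF t] bounded_linear.has_vector_derivative[OF blq df[OF t]]]])
    then have "((\<lambda>t. q z + (f z t - q (f z t))) has_vector_derivative f1 z t - q (f1 z t)) (at t)"
      by simp
    then show "((\<lambda>t. proj_along (\<Gamma> t) \<Delta> z) has_vector_derivative f1 z t - q (f1 z t)) (at t)"
      by (rule has_vector_derivative_transform_within_open[OF _ V(1) t]) (simp add: F)
  next
    fix z
    show "((\<lambda>t. f1 z t - q (f1 z t)) has_vector_derivative X z - q (X z)) (at \<tau>)"
      by (rule has_vector_derivative_diff[OF df1 bounded_linear.has_vector_derivative[OF blq df1]])
  qed
qed

section \<open>Iterated derivatives and smooth curves\<close>

lemma nth_vderiv_0: "nth_vderiv 0 f = f"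
  by (simp add: nth_vderiv_def)

lemma nth_vderiv_Suc: "nth_vderiv (Suc k) f = (\<lambda>t. vector_derivative (nth_vderiv k f) (at t))"
  by (simp add: nth_vderiv_def)

lemma nth_vderiv_cong_open:
  assumes "open S" "\<And>t. t \<in> S \<Longrightarrow> f t = g t" "t \<in> S"
  shows "nth_vderiv k f t = nth_vderiv k g t"
  using assms(3)
proof (induction k arbitrary: t)
  case (Suc k)
  have "(nth_vderiv k f has_vector_derivative d) (at t) \<longleftrightarrow>
      (nth_vderiv k g has_vector_derivative d) (at t)" for d
    using has_vector_derivative_transform_within_open[OF _ assms(1) Suc.prems] Suc.IH
    by metis
  then show ?case by (simp add: nth_vderiv_Suc vector_derivative_def)
qed (simp add: nth_vderiv_0 assms)

text \<open>The constant cancels in difference quotients, so \<open>vector_derivative\<close>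
  chooses from the same set of values for both functions, even at points of
  non-differentiability.\<close>

lemma nth_vderiv_add_const:
  "nth_vderiv k (\<lambda>t. c + f t) = (if k = 0 then (\<lambda>t. c + f t) else nth_vderiv k f)"
proof (induction k)
  case (Suc k)
  have "vector_derivative (\<lambda>t. c + f t) (at t) = vector_derivative f (at t)" for t
    by (simp add: vector_derivative_def has_vector_derivative_iff_quotient)
  then show ?case using Suc by (auto simp: nth_vderiv_Suc nth_vderiv_0)
qed (simp add: nth_vderiv_0)

lemma nth_vderiv_2_eqI:
  assumes S: "open S" "s \<in> S" and f: "\<And>t. t \<in> S \<Longrightarrow> (f has_vector_derivative f1 t) (at t)"
    and f1: "(f1 has_vector_derivative f2) (at s)"
  shows "nth_vderiv 2 f s = f2"
proof -
  have "((\<lambda>t. vector_derivative f (at t)) has_vector_derivative f2) (at s)"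
    by (rule has_vector_derivative_transform_within_open[OF f1 S])
       (simp add: vector_derivative_at[OF f])
  then show ?thesis
    by (simp add: numeral_2_eq_2 nth_vderiv_Suc nth_vderiv_0 vector_derivative_at)
qed

lemma smooth_curve_on_cong_open:
  assumes "open S" "\<And>t. t \<in> S \<Longrightarrow> f t = g t" "smooth_curve_on S f"
  shows "smooth_curve_on S g"
  unfolding smooth_curve_on_def
proof (intro allI ballI)
  fix k t assume t: "t \<in> S"
  then obtain d where d: "(nth_vderiv k f has_derivative d) (at t)"
    using assms(3) by (auto simp: smooth_curve_on_def differentiable_def)
  have "(nth_vderiv k g has_derivative d) (at t)"
    by (rule has_derivative_transform_within_open[OF d assms(1) t])
       (rule nth_vderiv_cong_open[OF assms(1,2)])
  then show "nth_vderiv k g differentiable at t" by (auto simp: differentiable_def)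
qed

lemma smooth_curve_on_add_const:
  "smooth_curve_on S f \<Longrightarrow> smooth_curve_on S (\<lambda>t. c + f t)"
  unfolding smooth_curve_on_def nth_vderiv_add_const
  by (auto intro!: differentiable_add dest: spec[of _ 0] simp: nth_vderiv_0)

lemma smooth_curve_on_has_vector_derivative:
  "smooth_curve_on S f \<Longrightarrow> t \<in> S \<Longrightarrow>
    (nth_vderiv k f has_vector_derivative nth_vderiv (Suc k) f t) (at t)"
  unfolding nth_vderiv_Suc smooth_curve_on_def by (metis vector_derivative_works)

section \<open>Charts and the velocity form\<close>

text \<open>Smoothness of the chart on \<open>\<Gamma>0\<close> passes to the projection of an
  arbitrary \<open>z\<close>: the \<open>\<Delta>0\<close>-component of \<open>z\<close> is killed,
  and on its \<open>\<Gamma>0\<close>-component the projection is the identity plus the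
  chart.\<close>

lemma lagrangian_curve_chart:
  fixes \<omega> :: "'a::euclidean_space \<Rightarrow> 'a \<Rightarrow> real"
  assumes sym: "symplectic_form \<omega>" and "smooth_lagrangian_curve \<omega> I \<Gamma>" and "\<tau> \<in> I"
  obtains \<Delta>0 J where "\<Delta>0 \<in> lagrangian_grassmannian \<omega>" "open J" "\<tau> \<in> J" "J \<subseteq> I"
    "\<And>t. t \<in> J \<Longrightarrow> complementary (\<Gamma> t) \<Delta>0"
    "\<And>z. smooth_curve_on J (\<lambda>t. proj_along (\<Gamma> t) \<Delta>0 z)"
proof -
  obtain \<Delta>0 \<Gamma>0 J where D: "\<Delta>0 \<in> lagrangian_grassmannian \<omega>" "\<Gamma>0 \<in> transversals \<omega> \<Delta>0"
    and J: "open J" "\<tau> \<in> J" "J \<subseteq> I"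
    and tr: "\<And>t. t \<in> J \<Longrightarrow> \<Gamma> t \<in> transversals \<omega> \<Delta>0"
    and sm: "\<And>v. v \<in> \<Gamma>0 \<Longrightarrow> smooth_curve_on J (\<lambda>t. graph_map \<Gamma>0 (\<Gamma> t) \<Delta>0 v)"
    using assms by (auto simp: smooth_lagrangian_curve_def)
  have c0: "complementary \<Gamma>0 \<Delta>0" and c: "\<And>t. t \<in> J \<Longrightarrow> complementary (\<Gamma> t) \<Delta>0"
    using D tr lagrangian_complementary[OF sym] by (auto simp: transversals_def)
  have "smooth_curve_on J (\<lambda>t. proj_along (\<Gamma> t) \<Delta>0 z)" for z
  proof -
    define w where "w = proj_along \<Gamma>0 \<Delta>0 z"
    have w: "w \<in> \<Gamma>0" "z - w \<in> \<Delta>0"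
      unfolding w_def by (rule proj_along_in[OF c0] proj_along_compl[OF c0])+
    have eq: "w + graph_map \<Gamma>0 (\<Gamma> t) \<Delta>0 w = proj_along (\<Gamma> t) \<Delta>0 z" if "t \<in> J" for t
    proof -
      have "proj_along (\<Gamma> t) \<Delta>0 (z - w) = 0"
        using w(2) by (simp add: proj_along_eq_0_iff[OF c[OF that]])
      then show ?thesis
        by (simp add: graph_map_eq_proj_along[OF c[OF that] w(1)]
            linear_diff[OF linear_proj_along[OF c[OF that]]])
    qed
    show ?thesis
      by (rule smooth_curve_on_cong_open[OF J(1) eq smooth_curve_on_add_const[OF sm[OF w(1)]]])
  qed
  then show ?thesis using that D J c by blast
qed

text \<open>Independence of the chosen curve: for a second curve \<open>v\<close> with the same
  value at \<open>\<tau>\<close>, differentiating \<open>\<omega> (x t) (v t) = 0\<close> and using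
  skewness shows that both curves give the same number.\<close>

lemma velocity_form_eq:
  fixes \<omega> :: "'a::euclidean_space \<Rightarrow> 'a \<Rightarrow> real"
  assumes sym: "symplectic_form \<omega>" and J: "open J" "\<tau> \<in> J" "J \<subseteq> I"
    and lag: "\<And>t. t \<in> J \<Longrightarrow> \<Gamma> t \<in> lagrangian_grassmannian \<omega>"
    and sm: "smooth_curve_on J x" and x: "\<And>t. t \<in> J \<Longrightarrow> x t \<in> \<Gamma> t"
  shows "velocity_form \<omega> I \<Gamma> \<tau> (x \<tau>) = \<omega> (x \<tau>) (vector_derivative x (at \<tau>))"
  unfolding velocity_form_def
proof (rule the_equality)
  show "\<exists>v J. open J \<and> \<tau> \<in> J \<and> J \<subseteq> I \<and> smooth_curve_on J v \<and> (\<forall>t\<in>J. v t \<in> \<Gamma> t) \<and> v \<tau> = x \<tau> \<and>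
      \<omega> (x \<tau>) (vector_derivative x (at \<tau>)) = \<omega> (x \<tau>) (vector_derivative v (at \<tau>))"
    using J sm x by blast
next
  fix r assume "\<exists>v J. open J \<and> \<tau> \<in> J \<and> J \<subseteq> I \<and> smooth_curve_on J v \<and> (\<forall>t\<in>J. v t \<in> \<Gamma> t) \<and>
      v \<tau> = x \<tau> \<and> r = \<omega> (x \<tau>) (vector_derivative v (at \<tau>))"
  then obtain v K where K: "open K" "\<tau> \<in> K" and smv: "smooth_curve_on K v"
    and v: "\<And>t. t \<in> K \<Longrightarrow> v t \<in> \<Gamma> t" "v \<tau> = x \<tau>"
    and r: "r = \<omega> (x \<tau>) (vector_derivative v (at \<tau>))" by blast
  have bb: "bounded_bilinear \<omega>"
    using sym by (simp add: symplectic_form_def bilinear_conv_bounded_bilinear)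
  have dx: "(x has_vector_derivative vector_derivative x (at \<tau>)) (at \<tau>)"
    using smooth_curve_on_has_vector_derivative[OF sm J(2), of 0]
    by (simp add: nth_vderiv_0 nth_vderiv_Suc)
  have dv: "(v has_vector_derivative vector_derivative v (at \<tau>)) (at \<tau>)"
    using smooth_curve_on_has_vector_derivative[OF smv K(2), of 0]
    by (simp add: nth_vderiv_0 nth_vderiv_Suc)
  have "\<omega> (x t) (v t) = 0" if "t \<in> J \<inter> K" for t
    using that lag x v(1) by (intro lagrangian_isotropic[of "\<Gamma> t"]) auto
  then have "\<omega> (x \<tau>) (vector_derivative v (at \<tau>)) + \<omega> (vector_derivative x (at \<tau>)) (v \<tau>) = 0"
    using J K by (intro has_vector_derivative_zero_on_open[of "J \<inter> K" _ _ 0,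
          OF _ _ _ bounded_bilinear.has_vector_derivative[OF bb dx dv]]) auto
  then show "r = \<omega> (x \<tau>) (vector_derivative x (at \<tau>))"
    using symplectic_skew[OF sym, of "vector_derivative x (at \<tau>)" "x \<tau>"] v r by simp
qed

section \<open>Linear algebra of the condition on the transversal\<close>

text \<open>The condition prescribes the projection onto \<open>L\<close> along
  \<open>\<Delta>\<close> on \<open>D\<close>. On \<open>L\<close> that projection is the identity,
  so it is known everywhere and \<open>\<Delta>\<close> is its kernel.\<close>

lemma unique_transversal:
  fixes \<omega> :: "'a::euclidean_space \<Rightarrow> 'a \<Rightarrow> real"
  assumes sym: "symplectic_form \<omega>"
    and L: "L \<in> lagrangian_grassmannian \<omega>" and D: "D \<in> lagrangian_grassmannian \<omega>"
    and int: "L \<inter> D = {0}"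
    and linA: "linear A" and linA2: "linear A2"
    and A: "\<And>v. A v \<in> D" and A2: "\<And>v. A2 v \<in> D"
    and symA: "\<And>u v. u \<in> L \<Longrightarrow> v \<in> L \<Longrightarrow> \<omega> u (A v) = \<omega> v (A u)"
    and symA2: "\<And>u v. u \<in> L \<Longrightarrow> v \<in> L \<Longrightarrow> \<omega> u (A2 v) = \<omega> v (A2 u)"
    and ker: "\<And>v. v \<in> L \<Longrightarrow> A v = 0 \<Longrightarrow> v = 0"
  shows "\<exists>!\<Delta>. \<Delta> \<in> transversals \<omega> L \<and> (\<forall>v\<in>L. A2 v = 2 *\<^sub>R A (proj_along L \<Delta> (A v)))"
proof -
  have b: "bilinear \<omega>" and nd: "\<And>u. (\<forall>v. \<omega> u v = 0) \<Longrightarrow> u = 0"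
    using sym by (auto simp: symplectic_form_def)
  have sub: "subspace L" "subspace D"
    using L D by (auto simp: lagrangian_grassmannian_def)
  have cLD: "complementary L D" by (rule lagrangian_complementary[OF sym L D int])
  have inj: "inj_on A L"
    by (rule inj_onI) (metis ker linear_diff[OF linA] right_minus_eq sub(1) subspace_diff)
  have "dim (A ` L) = dim D"
    using dim_image_eq[OF linA, of L] inj sub(1) lagrangian_dim[OF sym L] lagrangian_dim[OF sym D]
    by (simp add: span_eq_iff[THEN iffD2])
  then have img: "A ` L = D"
    using subspace_dim_equal[OF linear_subspace_image[OF linA sub(1)] sub(2)] A by auto
  \<comment> \<open>\<open>g\<close> inverts \<open>A\<close> between \<open>L\<close> and
    \<open>D\<close>; equality of dimensions has made \<open>A\<close> map \<open>L\<close> onto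
    \<open>D\<close>.\<close>
  obtain g where ling: "linear g" and gL: "\<And>x. g x \<in> L" and gA: "\<And>v. v \<in> L \<Longrightarrow> g (A v) = v"
    using linear_exists_left_inverse_on[OF linA sub(1) inj] by blast
  have Ag: "A (g w) = w" if "w \<in> D" for w
    using that gA unfolding img[symmetric] by auto
  define C where "C w = (1/2) *\<^sub>R g (A2 (g w))" for w
  have linC: "linear C"
    unfolding C_def
    using linear_compose[OF ling linear_compose[OF linA2 ling]]
    by (intro linear_compose_scale_right) (simp add: o_def)
  have CL: "C w \<in> L" for w unfolding C_def using gL sub by (auto intro: subspace_scale)
  have eq_iff: "(\<forall>v\<in>L. A2 v = 2 *\<^sub>R A (proj_along L \<Delta> (A v))) \<longleftrightarrow> (\<forall>w\<in>D. proj_along L \<Delta> w = C w)"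
    if c: "complementary L \<Delta>" for \<Delta>
  proof
    assume *: "\<forall>v\<in>L. A2 v = 2 *\<^sub>R A (proj_along L \<Delta> (A v))"
    show "\<forall>w\<in>D. proj_along L \<Delta> w = C w"
    proof
      fix w assume w: "w \<in> D"
      have "A2 (g w) = 2 *\<^sub>R A (proj_along L \<Delta> w)" using * gL Ag[OF w] by metis
      then have "C w = g (A (proj_along L \<Delta> w))"
        by (simp add: C_def linear_cmul[OF ling])
      then show "proj_along L \<Delta> w = C w" using gA[OF proj_along_in[OF c]] by simp
    qed
  next
    assume *: "\<forall>w\<in>D. proj_along L \<Delta> w = C w"
    show "\<forall>v\<in>L. A2 v = 2 *\<^sub>R A (proj_along L \<Delta> (A v))"
      using * A by (simp add: C_def linear_cmul[OF linA] gA Ag A2)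
  qed
  \<comment> \<open>This is what makes the set of all \<open>w - C w\<close> isotropic. Symmetry of
    \<open>A\<close> moves \<open>g\<close> across the form, and symmetry of \<open>A2\<close> makes
    \<open>\<omega> w (C w')\<close> symmetric in \<open>w\<close> and \<open>w'\<close>.\<close>
  have skewC: "\<omega> w (C w') + \<omega> (C w) w' = 0" if w: "w \<in> D" "w' \<in> D" for w w'
  proof -
    have h: "2 * \<omega> (A u) (C (A u')) = - \<omega> u (A2 u')" if "u \<in> L" "u' \<in> L" for u u'
    proof -
      have "2 * \<omega> (A u) (C (A u')) = \<omega> (A u) (g (A2 u'))"
        by (simp add: C_def gA that bilinear_rmul[OF b])
      also have "\<dots> = - \<omega> (g (A2 u')) (A u)" by (rule symplectic_skew[OF sym])
      also have "\<dots> = - \<omega> u (A (g (A2 u')))" using symA[OF gL that(1)] by simp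
      finally show ?thesis by (simp add: Ag A2)
    qed
    have "2 * \<omega> w (C w') = 2 * \<omega> w' (C w)"
      using h[OF gL gL, of w w'] h[OF gL gL, of w' w] symA2[OF gL gL, of w w'] w by (simp add: Ag)
    then show ?thesis using symplectic_skew[OF sym, of "C w" w'] by simp
  qed
  \<comment> \<open>A projection that is the identity on \<open>L\<close> and \<open>C\<close> on
    \<open>D\<close> has exactly these vectors as its kernel.\<close>
  define \<Delta> where "\<Delta> = (\<lambda>w. w - C w) ` D"
  have lin: "linear (\<lambda>w. w - C w)" by (intro linear_compose_sub linear_ident linC)
  have sub\<Delta>: "subspace \<Delta>" unfolding \<Delta>_def by (rule linear_subspace_image[OF lin sub(2)])
  have iso: "\<omega> x y = 0" if xy: "x \<in> \<Delta>" "y \<in> \<Delta>" for x y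
  proof -
    obtain w w' where w: "w \<in> D" "w' \<in> D" "x = w - C w" "y = w' - C w'"
      using xy unfolding \<Delta>_def by blast
    then show ?thesis
      using skewC[OF w(1,2)] lagrangian_isotropic[OF D w(1,2)] lagrangian_isotropic[OF L CL CL]
      by (simp add: bilinear_lsub[OF b] bilinear_rsub[OF b])
  qed
  \<comment> \<open>Maximality: subtracting the element of \<open>\<Delta>\<close> with the same
    \<open>D\<close>-component leaves \<open>y\<close> in \<open>L\<close>. It is orthogonal to both
    \<open>L\<close> and \<open>\<Delta>\<close>, hence to everything.\<close>
  have "x \<in> \<Delta>" if x: "\<forall>u\<in>\<Delta>. \<omega> u x = 0" for x
  proof -
    define l where "l = proj_along L D x"
    define d where "d = x - l"
    have d: "d \<in> D" "l \<in> L"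
      unfolding d_def l_def by (rule proj_along_in[OF cLD] proj_along_compl[OF cLD])+
    define y where "y = x - (d - C d)"
    have yL: "y \<in> L" using d CL sub by (auto simp: y_def d_def intro: subspace_add)
    have "\<omega> u y = 0" if "u \<in> \<Delta>" for u
      using x that iso[OF that, of "d - C d"] d by (auto simp: y_def \<Delta>_def bilinear_rsub[OF b])
    then have y\<Delta>: "\<omega> y u = 0" if "u \<in> \<Delta>" for u
      using that symplectic_skew[OF sym, of y u] by simp
    have "\<omega> y z = 0" for z
    proof -
      define w where "w = z - proj_along L D z"
      have w: "w \<in> D" unfolding w_def by (rule proj_along_compl[OF cLD])
      have "\<omega> y (proj_along L D z) = 0" "\<omega> y (C w) = 0" "\<omega> y (w - C w) = 0"
        using lagrangian_isotropic[OF L yL] proj_along_in[OF cLD] CL y\<Delta> w by (auto simp: \<Delta>_def)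
      then have "\<omega> y (proj_along L D z + (w - C w) + C w) = 0"
        by (simp only: bilinear_radd[OF b])
      then show ?thesis by (simp add: w_def)
    qed
    then have "y = 0" using nd by blast
    then show ?thesis using d by (auto simp: y_def \<Delta>_def)
  qed
  then have lag: "\<Delta> \<in> lagrangian_grassmannian \<omega>"
    using sub\<Delta> iso by (auto simp: lagrangian_grassmannian_def)
  have "\<Delta> \<inter> L = {0}"
  proof -
    have "x = 0" if x: "x \<in> \<Delta>" "x \<in> L" for x
    proof -
      obtain w where w: "w \<in> D" "x = w - C w" using x unfolding \<Delta>_def by blast
      then have "w = x + C w" by simp
      then have "w \<in> L" using x CL sub by (metis subspace_add)
      then have "w = 0" using w int by auto
      then show ?thesis using w by (simp add: linear_0[OF linC])
    qed
    then show ?thesis using sub sub\<Delta> by (auto simp: subspace_0)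
  qed
  then have tr: "\<Delta> \<in> transversals \<omega> L" using lag by (simp add: transversals_def)
  have compl: "complementary L \<Delta>'" if "\<Delta>' \<in> transversals \<omega> L" for \<Delta>'
    using that by (intro lagrangian_complementary[OF sym L]) (auto simp: transversals_def)
  have sol: "\<forall>w\<in>D. proj_along L \<Delta> w = C w"
    using proj_along_eqI[OF compl[OF tr] CL] by (auto simp: \<Delta>_def)
  show ?thesis
  proof (rule ex1I[of _ \<Delta>])
    show "\<Delta> \<in> transversals \<omega> L \<and> (\<forall>v\<in>L. A2 v = 2 *\<^sub>R A (proj_along L \<Delta> (A v)))"
      using tr sol eq_iff[OF compl[OF tr]] by simp
  next
    fix \<Delta>' assume *: "\<Delta>' \<in> transversals \<omega> L \<and> (\<forall>v\<in>L. A2 v = 2 *\<^sub>R A (proj_along L \<Delta>' (A v)))"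
    then have c': "complementary L \<Delta>'" and eq': "\<forall>w\<in>D. proj_along L \<Delta>' w = C w"
      using compl eq_iff by auto
    \<comment> \<open>The two projections agree on \<open>L\<close> and on \<open>D\<close>, so they
      agree everywhere and have the same kernel.\<close>
    have "proj_along L \<Delta>' x = proj_along L \<Delta> x" for x
    proof -
      define l where "l = proj_along L D x"
      have d: "x - l \<in> D" "l \<in> L"
        unfolding l_def by (rule proj_along_in[OF cLD] proj_along_compl[OF cLD])+
      have "proj_along L E x = l + C (x - l)"
        if c: "complementary L E" and e: "\<forall>w\<in>D. proj_along L E w = C w" for E
        using e d proj_along_ident[OF c d(2)] linear_add[OF linear_proj_along[OF c], of l "x - l"]
        by simp
      then show ?thesis using c' eq' compl[OF tr] sol by metis
    qed
    then show "\<Delta>' = \<Delta>"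
      using proj_along_eq_0_iff[OF c'] proj_along_eq_0_iff[OF compl[OF tr]] by auto
  qed
qed

section \<open>From the vanishing second derivative to the linear condition\<close>

theorem theorem1:
  fixes \<omega> :: "'a::euclidean_space \<Rightarrow> 'a \<Rightarrow> real"
    and n :: nat and I :: "real set" and \<Gamma> :: "real \<Rightarrow> 'a set"
  assumes "symplectic_form \<omega>" and "DIM('a) = 2 * n"
    and "open I" and "is_interval I"
    and "regular_jacobi_curve \<omega> I \<Gamma>"
  shows "\<forall>\<tau>\<in>I. \<exists>!\<Delta>. \<Delta> \<in> transversals \<omega> (\<Gamma> \<tau>) \<and>
    (\<forall>\<Gamma>0\<in>transversals \<omega> \<Delta>. \<forall>v\<in>\<Gamma>0. affine_nth_deriv 2 \<Gamma>0 \<Delta> \<Gamma> \<tau> v = 0)"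
proof
  fix \<tau> assume \<tau>: "\<tau> \<in> I"
  note sym = assms(1)
  have b: "bilinear \<omega>" using sym by (auto simp: symplectic_form_def)
  have bb: "bounded_bilinear \<omega>" using b by (simp add: bilinear_conv_bounded_bilinear)
  have sm: "smooth_lagrangian_curve \<omega> I \<Gamma>"
    and nondeg: "nondegenerate_quadratic_form_on (\<Gamma> \<tau>) (velocity_form \<omega> I \<Gamma> \<tau>)"
    using assms(5) \<tau> by (auto simp: regular_jacobi_curve_def)
  obtain \<Delta>0 J where D0: "\<Delta>0 \<in> lagrangian_grassmannian \<omega>" and J: "open J" "\<tau> \<in> J" "J \<subseteq> I"
    and c0: "\<And>t. t \<in> J \<Longrightarrow> complementary (\<Gamma> t) \<Delta>0"
    and smE: "\<And>z. smooth_curve_on J (\<lambda>t. proj_along (\<Gamma> t) \<Delta>0 z)"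
    using lagrangian_curve_chart[OF sym sm \<tau>] by blast
  have lag: "\<Gamma> t \<in> lagrangian_grassmannian \<omega>" if "t \<in> J" for t
    using sm J that by (auto simp: smooth_lagrangian_curve_def)
  note L = lag[OF J(2)]
  define L where "L = \<Gamma> \<tau>"
  define E where "E t = proj_along (\<Gamma> t) \<Delta>0" for t
  define E1 where "E1 t z = nth_vderiv 1 (\<lambda>t. E t z) t" for t z
  define E2 where "E2 z = nth_vderiv 2 (\<lambda>t. E t z) \<tau>" for z
  have dE: "((\<lambda>t. E t z) has_vector_derivative E1 t z) (at t)" if "t \<in> J" for t z
    using smooth_curve_on_has_vector_derivative[OF smE that, of 0 z]
    by (simp add: E_def E1_def nth_vderiv_0)
  have dE1: "((\<lambda>t. E1 t z) has_vector_derivative E2 z) (at \<tau>)" for z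
    using smooth_curve_on_has_vector_derivative[OF smE J(2), of 1 z]
    by (simp add: E_def E1_def E2_def numeral_2_eq_2)
  have linE: "linear (E t)" if "t \<in> J" for t
    unfolding E_def by (rule linear_proj_along[OF c0[OF that]])
  have linE1: "linear (E1 t)" if "t \<in> J" for t
    by (rule linear_vector_derivative_family[OF J(1) that linE dE[OF that]])
  have linE2: "linear E2" by (rule linear_vector_derivative_family[OF J(1,2) linE1 dE1])
  have Eid: "E \<tau> v = v" if "v \<in> L" for v
    using that unfolding E_def L_def by (rule proj_along_ident[OF c0[OF J(2)]])
  have EG: "E t v \<in> \<Gamma> t" if "t \<in> J" for t v
    unfolding E_def by (rule proj_along_in[OF c0[OF that]])

  have blP: "bounded_linear (E \<tau>)" using linE[OF J(2)] by (rule linear_conv_bounded_linear[THEN iffD1])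
  have ker\<tau>: "E \<tau> z = 0 \<longleftrightarrow> z \<in> \<Delta>0" for z
    unfolding E_def by (rule proj_along_eq_0_iff[OF c0[OF J(2)]])
  \<comment> \<open>Projections along the same \<open>\<Delta>0\<close> compose to the outer one.
    Differentiating this identity twice places the derivatives in the kernel
    \<open>\<Delta>0\<close> of \<open>E \<tau>\<close>.\<close>
  have const: "E \<tau> (E t z) = E \<tau> z" if "t \<in> J" for t z
  proof -
    have "E \<tau> (z - E t z) = 0"
      unfolding ker\<tau> unfolding E_def by (rule proj_along_compl[OF c0[OF that]])
    then show ?thesis by (simp add: linear_diff[OF linE[OF J(2)]])
  qed
  have PE1: "E \<tau> (E1 t z) = 0" if "t \<in> J" for t z
    by (rule has_vector_derivative_zero_on_open[OF J(1) that const
          bounded_linear.has_vector_derivative[OF blP dE[OF that]]])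
  have PE2: "E \<tau> (E2 z) = 0" for z
    by (rule has_vector_derivative_zero_on_open[OF J(1,2) PE1
          bounded_linear.has_vector_derivative[OF blP dE1]])
  have E1D: "E1 \<tau> z \<in> \<Delta>0" and E2D: "E2 z \<in> \<Delta>0" for z
    using PE1[OF J(2)] PE2 by (simp_all add: ker\<tau>)

  \<comment> \<open>Isotropy of \<open>\<Gamma> t\<close>, differentiated once here and again at
    \<open>\<tau>\<close> below, yields the symmetry of both derivatives on \<open>L\<close>; the
    cross terms of the second identity vanish because \<open>\<Delta>0\<close> is isotropic.\<close>
  have iso1: "\<omega> (E t u) (E1 t v) + \<omega> (E1 t u) (E t v) = 0" if t: "t \<in> J" for t u v
    by (rule has_vector_derivative_zero_on_open[OF J(1) t lagrangian_isotropic[OF lag EG EG]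
          bounded_bilinear.has_vector_derivative[OF bb dE[OF t] dE[OF t]]])
  have iso2: "(\<omega> (E \<tau> u) (E2 v) + \<omega> (E1 \<tau> u) (E1 \<tau> v)) + (\<omega> (E1 \<tau> u) (E1 \<tau> v) + \<omega> (E2 u) (E \<tau> v)) = 0"
    for u v
    by (rule has_vector_derivative_zero_on_open[OF J(1,2) iso1
          has_vector_derivative_add[OF
            bounded_bilinear.has_vector_derivative[OF bb dE[OF J(2)] dE1]
            bounded_bilinear.has_vector_derivative[OF bb dE1 dE[OF J(2)]]]])
  have sym1: "\<omega> u (E1 \<tau> v) = \<omega> v (E1 \<tau> u)" if "u \<in> L" "v \<in> L" for u v
    using iso1[OF J(2), of u v] symplectic_skew[OF sym, of "E1 \<tau> u" v] that by (simp add: Eid)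
  have sym2: "\<omega> u (E2 v) = \<omega> v (E2 u)" if "u \<in> L" "v \<in> L" for u v
    using iso2[of u v] symplectic_skew[OF sym, of "E2 u" v] that
      lagrangian_isotropic[OF D0 E1D E1D] by (simp add: Eid)

  \<comment> \<open>The curve \<open>E t v\<close> lies in \<open>\<Gamma> t\<close> and passes
    through \<open>v\<close> at \<open>\<tau>\<close>.\<close>
  have vel: "velocity_form \<omega> I \<Gamma> \<tau> v = \<omega> v (E1 \<tau> v)" if "v \<in> L" for v
    using velocity_form_eq[where I = I and \<Gamma> = \<Gamma>,
        OF sym J lag smE[folded E_def] EG, of v] vector_derivative_at[OF dE[OF J(2)]] that
    by (simp add: Eid)
  have subL: "subspace L" using L by (simp add: L_def lagrangian_grassmannian_def)
  \<comment> \<open>By \<open>sym1\<close> the polar form of the velocity form is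
    \<open>2 * \<omega> v (E1 \<tau> u)\<close>, so a kernel vector of \<open>E1 \<tau>\<close> in
    \<open>L\<close> contradicts nondegeneracy unless it is 0.\<close>
  have ker: "u = 0" if u: "u \<in> L" "E1 \<tau> u = 0" for u
  proof -
    have "velocity_form \<omega> I \<Gamma> \<tau> (u + v) - velocity_form \<omega> I \<Gamma> \<tau> u - velocity_form \<omega> I \<Gamma> \<tau> v = 0"
      if v: "v \<in> L" for v
      using u v sym1[OF u(1) v] subspace_add[OF subL u(1) v]
      by (simp add: vel linear_add[OF linE1[OF J(2)]] bilinear_ladd[OF b] bilinear_rzero[OF b])
    then show ?thesis using nondeg u by (auto simp: nondegenerate_quadratic_form_on_def L_def)
  qed

  have LI: "L \<in> lagrangian_grassmannian \<omega>" "L \<inter> \<Delta>0 = {0}"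
    using L c0[OF J(2)] by (simp_all add: L_def complementary_def)
  have deriv_iff: "(\<forall>\<Gamma>0\<in>transversals \<omega> \<Delta>. \<forall>v\<in>\<Gamma>0. affine_nth_deriv 2 \<Gamma>0 \<Delta> \<Gamma> \<tau> v = 0) \<longleftrightarrow>
      (\<forall>v\<in>L. E2 v = 2 *\<^sub>R E1 \<tau> (proj_along L \<Delta> (E1 \<tau> v)))"
    if tr: "\<Delta> \<in> transversals \<omega> (\<Gamma> \<tau>)" for \<Delta>
  proof -
    define q where "q = proj_along L \<Delta>"
    define X where "X z = E2 (q z) - 2 *\<^sub>R E1 \<tau> (q (E1 \<tau> (q z)))" for z
    have lag\<Delta>: "\<Delta> \<in> lagrangian_grassmannian \<omega>" "\<Gamma> \<tau> \<inter> \<Delta> = {0}"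
      using tr by (auto simp: transversals_def)
    have c: "complementary (\<Gamma> t) \<Delta>" if "t \<in> J" "\<Gamma> t \<inter> \<Delta> = {0}" for t
      by (rule lagrangian_complementary[OF sym lag[OF that(1)] lag\<Delta>(1) that(2)])
    note cL = c[OF J(2) lag\<Delta>(2), folded L_def]
    obtain V F1 where V: "open V" "\<tau> \<in> V" "V \<subseteq> J"
      and cV: "\<And>t. t \<in> V \<Longrightarrow> complementary (\<Gamma> t) \<Delta>"
      and F1: "\<And>t z. t \<in> V \<Longrightarrow> ((\<lambda>t. proj_along (\<Gamma> t) \<Delta> z) has_vector_derivative F1 t z) (at t)"
      and F2: "\<And>z. ((\<lambda>t. F1 t z) has_vector_derivative X z - q (X z)) (at \<tau>)"
      using proj_along_second_derivative[OF J(1,2) c0 c[OF J(2) lag\<Delta>(2)] c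
          dE[unfolded E_def] dE1, folded L_def, folded q_def, folded X_def]
      by blast
    \<comment> \<open>The origin \<open>\<Gamma>0\<close> enters only through the constant
      \<open>- v\<close>, which differentiation removes.\<close>
    have aff: "affine_nth_deriv 2 \<Gamma>0 \<Delta> \<Gamma> \<tau> v = X v - q (X v)" if "v \<in> \<Gamma>0" for \<Gamma>0 v
    proof -
      have "nth_vderiv 2 (\<lambda>s. graph_map \<Gamma>0 (\<Gamma> s) \<Delta> v) \<tau> =
          nth_vderiv 2 (\<lambda>s. - v + proj_along (\<Gamma> s) \<Delta> v) \<tau>"
        by (rule nth_vderiv_cong_open[OF V(1) _ V(2)])
           (simp add: graph_map_eq_proj_along[OF cV that])
      also have "\<dots> = nth_vderiv 2 (\<lambda>s. proj_along (\<Gamma> s) \<Delta> v) \<tau>"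
        by (simp only: nth_vderiv_add_const) simp
      also have "\<dots> = X v - q (X v)" by (rule nth_vderiv_2_eqI[OF V(1,2) F1 F2])
      finally show ?thesis by (simp add: affine_nth_deriv_def)
    qed
    have XD: "X z \<in> \<Delta>0" for z
      using E1D E2D D0 unfolding X_def lagrangian_grassmannian_def
      by (auto intro: subspace_diff subspace_scale)
    have qL: "q z \<in> L" for z unfolding q_def by (rule proj_along_in[OF cL])
    \<comment> \<open>If \<open>X z\<close> is fixed by \<open>q\<close>, it lies in
      \<open>L\<close> as well as in \<open>\<Delta>0\<close>.\<close>
    have X0: "X z - q (X z) = 0 \<longleftrightarrow> X z = 0" for z
    proof
      assume "X z - q (X z) = 0"
      then have "X z \<in> L" using qL[of "X z"] by simp
      then show "X z = 0" using XD LI(2) by auto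
    qed (simp add: q_def linear_0[OF linear_proj_along[OF cL]])
    \<comment> \<open>\<open>L\<close> itself is an admissible origin, which gives the forward
      direction of the next equivalence.\<close>
    have LT: "L \<in> transversals \<omega> \<Delta>"
      using LI(1) lag\<Delta>(2) by (simp add: transversals_def L_def)
    have "(\<forall>\<Gamma>0\<in>transversals \<omega> \<Delta>. \<forall>v\<in>\<Gamma>0. affine_nth_deriv 2 \<Gamma>0 \<Delta> \<Gamma> \<tau> v = 0) \<longleftrightarrow> (\<forall>v\<in>L. X v = 0)"
    proof
      assume "\<forall>\<Gamma>0\<in>transversals \<omega> \<Delta>. \<forall>v\<in>\<Gamma>0. affine_nth_deriv 2 \<Gamma>0 \<Delta> \<Gamma> \<tau> v = 0"
      then show "\<forall>v\<in>L. X v = 0" using LT aff X0 by metis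
    next
      assume *: "\<forall>v\<in>L. X v = 0"
      \<comment> \<open>\<open>X\<close> depends on \<open>z\<close> only through \<open>q z\<close>
        in \<open>L\<close>, so vanishing on \<open>L\<close> gives vanishing for every
        origin.\<close>
      have "q (q z) = q z" for z unfolding q_def by (rule proj_along_ident[OF cL proj_along_in[OF cL]])
      then have "X z = X (q z)" for z by (simp add: X_def)
      then have "X z = 0" for z using * qL by metis
      then show "\<forall>\<Gamma>0\<in>transversals \<omega> \<Delta>. \<forall>v\<in>\<Gamma>0. affine_nth_deriv 2 \<Gamma>0 \<Delta> \<Gamma> \<tau> v = 0"
        by (metis aff X0)
    qed
    also have "\<dots> \<longleftrightarrow> (\<forall>v\<in>L. E2 v = 2 *\<^sub>R E1 \<tau> (q (E1 \<tau> v)))"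
      by (simp add: X_def q_def proj_along_ident[OF cL])
    finally show ?thesis by (simp add: q_def)
  qed
  have "\<exists>!\<Delta>. \<Delta> \<in> transversals \<omega> L \<and> (\<forall>v\<in>L. E2 v = 2 *\<^sub>R E1 \<tau> (proj_along L \<Delta> (E1 \<tau> v)))"
    by (rule unique_transversal[OF sym LI(1) D0 LI(2) linE1[OF J(2)] linE2 E1D E2D sym1 sym2 ker])
  then show "\<exists>!\<Delta>. \<Delta> \<in> transversals \<omega> (\<Gamma> \<tau>) \<and>
      (\<forall>\<Gamma>0\<in>transversals \<omega> \<Delta>. \<forall>v\<in>\<Gamma>0. affine_nth_deriv 2 \<Gamma>0 \<Delta> \<Gamma> \<tau> v = 0)"
    unfolding L_def[symmetric] using deriv_iff[folded L_def]
    by (metis (no_types, lifting))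
qed

end
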